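(* Let $\mathbb{K}$ be a commutative field, let $\mathcal{X} = \{x_1, \ldots, x_d\}$ be a finite non-empty alphabet, and let $p \in \mathbb{K}\langle \mathcal{X}\rangle$ be an element of the free associative algebra with $\operatorname{rank} p = n \ge 2$. Then $$n-2 \;\le\; N(p) \;\le\; \tfrac{1}{2}(n-1)(n-2),$$ where $N(p)$ is the minimal number of multiplications $N(\mathcal{A})$ over all polynomial admissible linear systems $\mathcal{A}$ (of arbitrary dimension) for $p$.
   Context: $\mathbb{K}\langle \mathcal{X}\rangle$ denotes the free associative (unital) $\mathbb{K}$-algebra on the non-commuting letters $x_1,\ldots,x_d$, i.e. the algebra of non-commutative polynomials. **Linear representation, dimension, rank.** A linear representation of $p \in \mathbb{K}\langle \mathcal{X}\rangle$ is a triple $\pi = (u,A,v)$ where, for some $n \in \mathbb{N} = \{1,2,\ldots\}$, $u \in \mathbb{K}^{1\times n}$, $v \in \mathbb{K}^{n\times 1}$, and $A = (a_{ij})$ is an $n \times n$ matrix, invertible over $\mathbb{K}\langle \mathcal{X}\rangle$, whose entries have the form $a_{ij} = \kappa_{ij}^{(0)} + \kappa_{ij}^{(1)} x_1 + \cdots + \kappa_{ij}^{(d)} x_d$ with $\kappa_{ij}^{(\ell)} \in \mathbb{K}$, such that $p = u A^{-1} v$. Its dimension is $\dim \pi = n$. By convention, the "empty" representation $(,,)$ of dimension $0$ is the minimal linear representation of $p = 0$. The rank of $p$, $\operatorname{rank} p$, is the smallest dimension among all linear representations of $p$. **Polynomial admissible linear system (polynomial ALS).** A linear representation $\mathcal{A}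 = (u,A,v)$ of dimension $m$ of a non-zero $p \in \mathbb{K}\langle \mathcal{X}\rangle$ is called a polynomial ALS for $p$ if - $u = [1,0,\ldots,0]$, - $v = [0,\ldots,0,\lambda]^{\top}$ for some $\lambda \in \mathbb{K}$, - $a_{ii} = 1$ for all $i = 1,\ldots,m$ and $a_{ij} = 0$ for all $i > j$ (so $A$ is upper unitriangular). **Number of multiplications.** Let $\mathcal{A} = (u,A,v)$ be a polynomial ALS of dimension $m \ge 2$. The left number of multiplications $N_s(\mathcal{A})$ is the number of non-scalar entries (entries not belonging to $\mathbb{K}$) in the upper left $(m-1)\times(m-1)$ block of $A$. The right number of multiplications $N_t(\mathcal{A})$ is the number of non-scalar entries in the lower right $(m-1)\times(m-1)$ block of $A$. Set $N(\mathcal{A}) = \min\{N_s(\mathcal{A}), N_t(\mathcal{A})\}$. For $p$ of rank at least $2$ (so that every polynomial ALS for $p$ has dimension at least $2$), $N(p)$ is defined as $N(\mathcal{A})$ for a polynomial ALS $\mathcal{A}$ for $p$ satisfying $N(\mathcal{A}) \le N(\mathcal{B})$ for all polynomial ALS $\mathcal{B}$ for $p$; that is, $N(p) = \min_{\mathcal{A}} N(\mathcal{A})$ over all polynomial ALS $\mathcal{A}$ for $p$, of any dimension. *)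

theory Defs
  imports Complex_Main "HOL-Library.Poly_Mapping" "Jordan_Normal_Form.Matrix"
begin

text \<open>
  The free monoid on \<open>'x\<close> is a copy of \<open>'x list\<close>, written additively because the convolution
  product on \<open>\<Rightarrow>\<^sub>0\<close> in Poly_Mapping combines exponents with \<open>+\<close>. The addition is
  concatenation and is not commutative.
\<close>

datatype 'x free_monoid = Letters (letters: "'x list")

instantiation free_monoid :: (type) monoid_add
begin

definition zero_free_monoid :: "'a free_monoid"
  where "0 = Letters []"

definition plus_free_monoid :: "'a free_monoid \<Rightarrow> 'a free_monoid \<Rightarrow> 'a free_monoid"
  where "v + w = Letters (letters v @ letters w)"

instance
  by standard (simp_all add: zero_free_monoid_def plus_free_monoid_def)

end

text \<open>The free associative unital algebra, as the monoid algebra of the free monoid.\<close>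

type_synonym ('x, 'k) free_algebra = "'x free_monoid \<Rightarrow>\<^sub>0 'k"

definition scalar :: "'k \<Rightarrow> ('x, 'k::field) free_algebra"
  where "scalar c = Poly_Mapping.single 0 c"

definition letter :: "'x \<Rightarrow> ('x, 'k::field) free_algebra"
  where "letter x = Poly_Mapping.single (Letters [x]) 1"

definition is_scalar :: "('x, 'k::field) free_algebra \<Rightarrow> bool"
  where "is_scalar f \<longleftrightarrow> (\<exists>c. f = scalar c)"

definition is_affine_linear :: "('x::finite, 'k::field) free_algebra \<Rightarrow> bool"
  where "is_affine_linear f \<longleftrightarrow>
    (\<exists>c \<kappa>. f = scalar c + (\<Sum>x\<in>UNIV. scalar (\<kappa> x) * letter x))"

text \<open>
  In the following definition \<open>B\<close> is the inverse of \<open>A\<close>, and \<open>p = u A\<^sup>-\<^sup>1 v\<close> is stated as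
  an equation of \<open>1 \<times> 1\<close> matrices. For \<open>n = 0\<close> that product is an empty sum, so the empty
  representation represents exactly \<open>p = 0\<close>.
\<close>

definition linear_representation ::
    "nat \<Rightarrow> 'k mat \<Rightarrow> ('x::finite, 'k::field) free_algebra mat \<Rightarrow> 'k mat
      \<Rightarrow> ('x, 'k) free_algebra \<Rightarrow> bool"
  where "linear_representation n u A v p \<longleftrightarrow>
    u \<in> carrier_mat 1 n \<and> A \<in> carrier_mat n n \<and> v \<in> carrier_mat n 1 \<and>
    (\<forall>i<n. \<forall>j<n. is_affine_linear (A $$ (i, j))) \<and>
    (\<exists>B \<in> carrier_mat n n. inverts_mat A B \<and> inverts_mat B A \<and>
       map_mat scalar u * B * map_mat scalar v = mat 1 1 (\<lambda>_. p))"

definition nc_rank :: "('x::finite, 'k::field) free_algebra \<Rightarrow> nat"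
  where "nc_rank p = (LEAST n. \<exists>u A v. linear_representation n u A v p)"

text \<open>Matrix indices start at \<open>0\<close>.\<close>

definition polynomial_ALS ::
    "nat \<Rightarrow> 'k mat \<Rightarrow> ('x::finite, 'k::field) free_algebra mat \<Rightarrow> 'k mat
      \<Rightarrow> ('x, 'k) free_algebra \<Rightarrow> bool"
  where "polynomial_ALS m u A v p \<longleftrightarrow>
    p \<noteq> 0 \<and> linear_representation m u A v p \<and>
    (\<forall>j<m. u $$ (0, j) = (if j = 0 then 1 else 0)) \<and>
    (\<exists>l. \<forall>i<m. v $$ (i, 0) = (if i = m - 1 then l else 0)) \<and>
    (\<forall>i<m. A $$ (i, i) = 1) \<and>
    (\<forall>i<m. \<forall>j<i. A $$ (i, j) = 0)"

definition left_mults :: "nat \<Rightarrow> ('x, 'k::field) free_algebra mat \<Rightarrow> nat"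
  where "left_mults m A =
    card {(i, j). i < m - 1 \<and> j < m - 1 \<and> \<not> is_scalar (A $$ (i, j))}"

definition right_mults :: "nat \<Rightarrow> ('x, 'k::field) free_algebra mat \<Rightarrow> nat"
  where "right_mults m A =
    card {(i, j). 1 \<le> i \<and> i < m \<and> 1 \<le> j \<and> j < m \<and> \<not> is_scalar (A $$ (i, j))}"

definition ALS_mults :: "nat \<Rightarrow> ('x, 'k::field) free_algebra mat \<Rightarrow> nat"
  where "ALS_mults m A = min (left_mults m A) (right_mults m A)"

text \<open>
  The minimum ranges over systems of every dimension \<open>m\<close>. Only elements of rank at least \<open>2\<close>
  matter here, and for those every polynomial ALS has dimension at least \<open>2\<close>.
\<close>

definition num_mults :: "('x::finite, 'k::field) free_algebra \<Rightarrow> nat"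
  where "num_mults p = (LEAST k. \<exists>m u A v. polynomial_ALS m u A v p \<and> k = ALS_mults m A)"

end

theory Submission
  imports Defs
begin

text \<open>
  The rank of \<open>p\<close> is the dimension of the space spanned by its iterated left derivatives, where
  the derivative by a letter \<open>x\<close> collects the words starting with \<open>x\<close> and deletes that letter.
  If \<open>p = u A\<^sup>-\<^sup>1 v\<close>, the entries of \<open>A\<^sup>-\<^sup>1 v\<close> span a space that contains \<open>p\<close> and is closed under
  derivatives. Conversely, derivatives lower the degree, so a finite-dimensional closed space has a
  basis in which every derivative of an element lies in the span of the later ones; expressing the
  derivatives in this basis gives a polynomial ALS of that dimension, and counting its entries gives
  the upper bound. For the lower bound, the derivatives of \<open>p\<close> computed from a polynomial ALS only
  involve \<open>1\<close> and one entry of \<open>A\<^sup>-\<^sup>1 v\<close> for each non-scalar column of the upper left block, or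
  for each non-scalar row of the lower right block, so the rank is at most \<open>N + 2\<close>.
\<close>

section \<open>Left derivatives in the free algebra\<close>

interpretation free_alg: vector_space "\<lambda>c f. (scalar c :: ('x, 'k::field) free_algebra) * f"
proof
  fix a b :: 'k and x y :: "('x, 'k) free_algebra"
  show "scalar a * (x + y) = scalar a * x + scalar a * y"
    by (simp add: distrib_left)
  show "scalar (a + b) * x = scalar a * x + scalar b * x"
    by (simp add: scalar_def single_add distrib_right)
  show "scalar a * (scalar b * x) = scalar (a * b) * x"
    by (simp add: scalar_def mult_single flip: mult.assoc)
  show "scalar 1 * x = x"
    by (simp add: scalar_def)
qed

lemma scalar_simps [simp]:
  "scalar 0 = 0" "scalar 1 = 1" "- scalar a = scalar (- a)"
  "scalar a + scalar b = scalar (a + b)" "scalar a * scalar b = scalar (a * b)"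
  by (simp_all add: scalar_def single_add mult_single single_uminus)

lemma is_scalar_simps [simp]: "is_scalar (scalar c)" "is_scalar 0" "is_scalar 1"
  unfolding is_scalar_def by (metis scalar_simps)+

lemma sum_single_lookup:
  "(\<Sum>w\<in>Poly_Mapping.keys f. Poly_Mapping.single w (Poly_Mapping.lookup f w)) = f"
  by (rule poly_mapping_eqI)
    (simp add: lookup_sum lookup_single when_def sum.delta' in_keys_iff)

text \<open>The product rules and the decomposition below are additive in each argument, so checking
  them on monomials suffices.\<close>

lemma free_algebra_induct [case_names single add]:
  fixes f :: "('x, 'k::field) free_algebra"
  assumes "\<And>w c. P (Poly_Mapping.single w c)" and "\<And>f g. P f \<Longrightarrow> P g \<Longrightarrow> P (f + g)"
  shows "P f"
proof -
  have "P 0"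
    using assms(1)[of 0 0] by simp
  then have "P (\<Sum>w\<in>W. Poly_Mapping.single w (Poly_Mapping.lookup f w))" for W
    by (induction W rule: infinite_finite_induct) (simp_all add: assms)
  then show ?thesis
    by (metis sum_single_lookup)
qed

definition const_coeff :: "('x, 'k::field) free_algebra \<Rightarrow> 'k"
  where "const_coeff f = Poly_Mapping.lookup f 0"

text \<open>Pulling coefficients back along prefixing by \<open>x\<close> keeps the support finite
  because prefixing is injective.\<close>

definition left_deriv :: "'x \<Rightarrow> ('x, 'k::field) free_algebra \<Rightarrow> ('x, 'k) free_algebra"
  where "left_deriv x f = Poly_Mapping.map_key (\<lambda>w. Letters [x] + w) f"

lemma inj_plus_letter: "inj (\<lambda>w. Letters [x] + w)"
  by (rule injI) (simp add: plus_free_monoid_def free_monoid.expand)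

lemma lookup_left_deriv:
  "Poly_Mapping.lookup (left_deriv x f) w = Poly_Mapping.lookup f (Letters [x] + w)"
  by (simp add: left_deriv_def map_key.rep_eq inj_plus_letter)

lemma const_coeff_add [simp]: "const_coeff (f + g) = const_coeff f + const_coeff g"
  by (simp add: const_coeff_def lookup_add)

lemma left_deriv_add [simp]: "left_deriv x (f + g) = left_deriv x f + left_deriv x g"
  by (rule poly_mapping_eqI) (simp add: lookup_left_deriv lookup_add)

lemma left_deriv_0 [simp]: "left_deriv x 0 = 0"
  by (rule poly_mapping_eqI) (simp add: lookup_left_deriv)

lemma left_deriv_uminus [simp]: "left_deriv x (- f) = - left_deriv x f"
  by (rule poly_mapping_eqI) (simp add: lookup_left_deriv)

lemma left_deriv_sum [simp]: "left_deriv x (\<Sum>i\<in>I. f i) = (\<Sum>i\<in>I. left_deriv x (f i))"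
  by (induction I rule: infinite_finite_induct) simp_all

lemma const_coeff_0 [simp]: "const_coeff 0 = 0"
  by (simp add: const_coeff_def)

lemma const_coeff_sum [simp]: "const_coeff (\<Sum>i\<in>I. f i) = (\<Sum>i\<in>I. const_coeff (f i))"
  by (induction I rule: infinite_finite_induct) simp_all

lemma const_coeff_scalar [simp]: "const_coeff (scalar c) = c"
  by (simp add: const_coeff_def scalar_def)

lemma const_coeff_1 [simp]: "const_coeff 1 = 1"
  by (metis const_coeff_scalar scalar_simps(2))

lemma const_coeff_single: "const_coeff (Poly_Mapping.single w c) = (if w = 0 then c else 0)"
  by (simp add: const_coeff_def lookup_single when_def)

lemma left_deriv_single:
  "left_deriv x (Poly_Mapping.single w c) =
    (case letters w of [] \<Rightarrow> 0 | y # v \<Rightarrow> if y = x then Poly_Mapping.single (Letters v) c else 0)"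
  by (rule poly_mapping_eqI, cases w)
    (auto simp: lookup_left_deriv lookup_single when_def plus_free_monoid_def free_monoid.expand
      split: list.split)

lemma left_deriv_scalar [simp]: "left_deriv x (scalar c) = 0"
  by (simp add: scalar_def left_deriv_single zero_free_monoid_def)

lemma const_coeff_mult [simp]: "const_coeff (f * g) = const_coeff f * const_coeff g"
proof (induction f rule: free_algebra_induct)
  case (single w c)
  show ?case
    by (induction g rule: free_algebra_induct)
      (auto simp: mult_single const_coeff_single distrib_left plus_free_monoid_def
        zero_free_monoid_def free_monoid.expand)
qed (simp add: distrib_right)

text \<open>A nonempty word of \<open>f\<close> provides the first letter of the product itself;
  only the constant term of \<open>f\<close> exposes the first letter of \<open>g\<close>.\<close>

lemma left_deriv_mult:
  "left_deriv x (f * g) = scalar (const_coeff f) * left_deriv x g + left_deriv x f * g"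
proof (induction f rule: free_algebra_induct)
  case (single w c)
  show ?case
  proof (induction g rule: free_algebra_induct)
    case (single v d)
    show ?case
      by (cases w; cases v) (auto simp: mult_single const_coeff_single left_deriv_single
          plus_free_monoid_def zero_free_monoid_def scalar_def split: list.split)
  qed (simp add: distrib_left)
qed (simp add: distrib_right flip: scalar_simps)

lemma left_deriv_scalar_mult [simp]: "left_deriv x (scalar c * f) = scalar c * left_deriv x f"
  by (simp add: left_deriv_mult)

lemma left_deriv_is_scalar: "is_scalar f \<Longrightarrow> left_deriv x f = 0"
  by (auto simp: is_scalar_def)

lemma left_deriv_letter: "left_deriv x (letter y) = (if x = y then 1 else 0)"
  by (simp add: letter_def left_deriv_single flip: zero_free_monoid_def)

text \<open>This lets derivatives of entries of \<open>A\<close> act as coefficients inside a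
  span.\<close>

lemma left_deriv_affine_linear:
  assumes "is_affine_linear f"
  shows "is_scalar (left_deriv x f)"
proof -
  obtain c \<kappa> where "f = scalar c + (\<Sum>y\<in>UNIV. scalar (\<kappa> y) * letter y)"
    using assms unfolding is_affine_linear_def by blast
  then have "left_deriv x f = scalar (\<kappa> x)"
    by (simp add: left_deriv_letter if_distrib cong: if_cong)
  then show ?thesis by simp
qed

text \<open>Every nonempty word starts with exactly one letter.\<close>

lemma free_algebra_decompose:
  fixes f :: "('x::finite, 'k::field) free_algebra"
  shows "f = scalar (const_coeff f) + (\<Sum>x\<in>UNIV. letter x * left_deriv x f)"
proof (induction f rule: free_algebra_induct)
  case (single w c)
  show ?case
  proof (cases "letters w")
    case Nil
    then have "w = 0" by (simp add: zero_free_monoid_def free_monoid.expand)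
    then show ?thesis
      by (simp add: const_coeff_single left_deriv_single zero_free_monoid_def)
        (simp add: scalar_def flip: zero_free_monoid_def)
  next
    case (Cons y v)
    then have w: "w = Letters (y # v)" by (simp add: free_monoid.expand)
    have "letter x * left_deriv x (Poly_Mapping.single w c) =
        (if x = y then Poly_Mapping.single w c else 0)" for x
      by (simp add: w letter_def left_deriv_single mult_single plus_free_monoid_def)
    then show ?thesis
      by (simp add: const_coeff_single) (simp add: w zero_free_monoid_def)
  qed
next
  case (add f g)
  have "scalar (const_coeff (f + g)) + (\<Sum>x\<in>UNIV. letter x * left_deriv x (f + g)) =
      (scalar (const_coeff f) + (\<Sum>x\<in>UNIV. letter x * left_deriv x f)) +
      (scalar (const_coeff g) + (\<Sum>x\<in>UNIV. letter x * left_deriv x g))"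
    by (simp add: distrib_left sum.distrib algebra_simps flip: scalar_simps)
  then show ?case using add by simp
qed

lemma scalar_letter_commute: "scalar c * letter x = letter x * scalar c"
  by (simp add: scalar_def letter_def mult_single)

lemma left_deriv_span:
  assumes "f \<in> free_alg.span T" and "\<And>t. t \<in> T \<Longrightarrow> left_deriv x t \<in> free_alg.span S"
  shows "left_deriv x f \<in> free_alg.span S"
  using assms(1)
proof (induction rule: free_alg.span_induct_alt)
  case base
  show ?case by (simp add: free_alg.span_zero)
next
  case (step c t f)
  then show ?case
    by (simp add: assms(2) free_alg.span_add free_alg.span_scale)
qed

section \<open>Derivative-closed subspaces\<close>

text \<open>Closure is asked of generators only; by linearity it passes to the whole span.\<close>

definition deriv_closed :: "('x, 'k::field) free_algebra set \<Rightarrow> bool"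
  where "deriv_closed T \<longleftrightarrow> (\<forall>t\<in>T. \<forall>x. left_deriv x t \<in> free_alg.span T)"

lemma deriv_closed_span:
  "deriv_closed T \<Longrightarrow> f \<in> free_alg.span T \<Longrightarrow> left_deriv x f \<in> free_alg.span T"
  by (rule left_deriv_span) (auto simp: deriv_closed_def)

text \<open>Such a list is a basis of its span in which differentiation is strictly triangular, the
  shape that a unitriangular system requires.\<close>

primrec deriv_chain :: "('x, 'k::field) free_algebra list \<Rightarrow> bool"
  where
    "deriv_chain [] \<longleftrightarrow> True"
  | "deriv_chain (q # L) \<longleftrightarrow> q \<notin> free_alg.span (set L) \<and>
      (\<forall>x. left_deriv x q \<in> free_alg.span (set L)) \<and> deriv_chain L"

lemma deriv_chain_independent:
  "deriv_chain L \<Longrightarrow> free_alg.independent (set L) \<and> distinct L"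
proof (induction L)
  case Nil
  show ?case using free_alg.independent_empty by simp
qed (auto simp: free_alg.independent_insert free_alg.span_base)

lemma deriv_chain_closed: "deriv_chain L \<Longrightarrow> deriv_closed (set L)"
  by (induction L) (auto simp: deriv_closed_def intro: subsetD[OF free_alg.span_mono])

lemma deriv_chain_drop: "deriv_chain L \<Longrightarrow> deriv_chain (drop k L)"
proof (induction L arbitrary: k)
  case (Cons q L)
  then show ?case by (cases k) auto
qed simp

lemma length_letters_bounded: "\<exists>N. \<forall>w\<in>Poly_Mapping.keys f. length (letters w) < N"
proof -
  have "finite ((\<lambda>w. length (letters w)) ` Poly_Mapping.keys f)" by simp
  then show ?thesis unfolding finite_nat_set_iff_bounded by blast
qed

text \<open>A chain of maximal length spans, since a missing element of least degree would extend it.\<close>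

lemma deriv_chain_spanning:
  fixes T :: "('x, 'k::field) free_algebra set"
  assumes "finite T" and closed: "deriv_closed T"
  obtains L where "deriv_chain L" "length L \<le> card T" "free_alg.span T \<subseteq> free_alg.span (set L)"
proof -
  define P where "P L \<longleftrightarrow> deriv_chain L \<and> set L \<subseteq> free_alg.span T" for L
  have bound: "length L \<le> card T" if "P L" for L
    using that deriv_chain_independent[of L] free_alg.independent_span_bound[OF assms(1), of "set L"]
    by (simp add: P_def distinct_card)
  have "P []" by (simp add: P_def)
  \<comment> \<open>Chains are independent, so \<open>card T\<close> bounds their length and a
    longest one exists.\<close>
  then obtain L where L: "P L" and max: "\<And>M. P M \<Longrightarrow> length M \<le> length L"
    using ex_has_greatest_nat[of P "[]" length "Suc (card T)"] bound le_imp_less_Suc by metis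
  \<comment> \<open>\<open>N\<close> strictly bounds the word lengths in \<open>f\<close>: the value
    \<open>0\<close> forces \<open>f = 0\<close>, and a derivative lowers the bound by one.\<close>
  have "f \<in> free_alg.span (set L)"
    if "f \<in> free_alg.span T" "\<And>w. Poly_Mapping.lookup f w \<noteq> 0 \<Longrightarrow> length (letters w) < N" for f N
    using that
  proof (induction N arbitrary: f)
    case 0
    then have "f = 0" by (intro poly_mapping_eqI) auto
    then show ?case by (simp add: free_alg.span_zero)
  next
    case (Suc N)
    have deriv: "left_deriv x f \<in> free_alg.span (set L)" for x
    proof (rule Suc.IH)
      show "left_deriv x f \<in> free_alg.span T"
        using closed Suc.prems(1) by (rule deriv_closed_span)
      show "length (letters w) < N" if "Poly_Mapping.lookup (left_deriv x f) w \<noteq> 0" for w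
        using Suc.prems(2)[of "Letters [x] + w"] that
        by (simp add: lookup_left_deriv plus_free_monoid_def)
    qed
    show ?case
    proof (rule ccontr)
      assume "f \<notin> free_alg.span (set L)"
      then have "P (f # L)" using L Suc.prems(1) deriv by (simp add: P_def)
      then show False using max by fastforce
    qed
  qed
  then have "free_alg.span T \<subseteq> free_alg.span (set L)"
    by (metis length_letters_bounded in_keys_iff subsetI)
  then show ?thesis using that L bound P_def by blast
qed

text \<open>Heads are discarded while \<open>p\<close> stays in the span of the tail; the first head
  whose removal would lose \<open>p\<close> is replaced by \<open>p\<close>, whose derivatives lie
  in that tail. As \<open>p\<close> is nonzero, this happens before the list is exhausted.\<close>

lemma deriv_chain_exchange:
  assumes "deriv_chain L" "p \<in> free_alg.span (set L)" "p \<noteq> 0"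
  shows "\<exists>M. deriv_chain (p # M) \<and> length (p # M) \<le> length L"
  using assms
proof (induction L)
  case (Cons r L)
  show ?case
  proof (cases "p \<in> free_alg.span (set L)")
    case True
    then show ?thesis using Cons by force
  next
    case False
    have "left_deriv x p \<in> free_alg.span (set L)" for x
      by (rule left_deriv_span[OF Cons.prems(2)])
        (use Cons.prems(1) deriv_chain_closed[of L] in \<open>auto simp: deriv_closed_def\<close>)
    then show ?thesis using False Cons.prems by (intro exI[of _ L]) auto
  qed
qed simp

section \<open>Coordinates with respect to a list\<close>

lemma span_set_list:
  assumes "f \<in> free_alg.span (set L)"
  shows "\<exists>c. f = (\<Sum>j<length L. scalar (c j) * L ! j)"
  using assms
proof (induction L arbitrary: f)
  case (Cons q L)
  then obtain k where "f - scalar k * q \<in> free_alg.span (set L)"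
    by (auto simp: free_alg.span_breakdown_eq)
  then obtain c where "f - scalar k * q = (\<Sum>j<length L. scalar (c j) * L ! j)"
    using Cons.IH by blast
  then have "f = (\<Sum>j<length (q # L). scalar (case_nat k c j) * (q # L) ! j)"
    by (simp add: sum.lessThan_Suc_shift diff_eq_eq add.commute del: sum.lessThan_Suc)
  then show ?case by blast
qed simp

lemma span_set_drop:
  assumes "f \<in> free_alg.span (set (drop k L))" "k \<le> length L"
  shows "\<exists>c. f = (\<Sum>j\<in>{k..<length L}. scalar (c j) * L ! j)"
proof -
  obtain c where "f = (\<Sum>j<length L - k. scalar (c j) * L ! (k + j))"
    using span_set_list[OF assms(1)] assms(2) by auto
  also have "\<dots> = (\<Sum>j\<in>{0 + k..<length L - k + k}. scalar (c (j - k)) * L ! j)"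
    by (simp only: sum.shift_bounds_nat_ivl) (simp add: add.commute lessThan_atLeast0)
  finally show ?thesis using assms(2) by (intro exI[of _ "\<lambda>j. c (j - k)"]) simp
qed

section \<open>Representations and derivative-closed subspaces\<close>

function back_subst :: "nat \<Rightarrow> (nat \<Rightarrow> nat \<Rightarrow> 'a::ring_1) \<Rightarrow> (nat \<Rightarrow> 'a) \<Rightarrow> nat \<Rightarrow> 'a"
  where "back_subst m A b i = b i - (\<Sum>l\<in>{i<..<m}. A i l * back_subst m A b l)"
  by auto
termination
  by (relation "measure (\<lambda>(m, A, b, i). m - i)") auto

declare back_subst.simps [simp del]

lemma sum_unitriangular:
  fixes a :: "nat \<Rightarrow> 'a::ring_1"
  assumes "i < m" "a i = 1" "\<And>j. j < i \<Longrightarrow> a j = 0"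
  shows "(\<Sum>j<m. a j * s j) = s i + (\<Sum>j\<in>{i<..<m}. a j * s j)"
proof -
  have "(\<Sum>j<m. a j * s j) = (\<Sum>j\<in>{i..<m}. a j * s j)"
    using assms by (intro sum.mono_neutral_right) auto
  also have "\<dots> = a i * s i + (\<Sum>j\<in>{Suc i..<m}. a j * s j)"
    using assms(1) by (rule sum.atLeast_Suc_lessThan)
  also have "{Suc i..<m} = {i<..<m}" by auto
  finally show ?thesis using assms(2) by simp
qed

text \<open>Column \<open>j\<close> of \<open>B\<close> comes from back substitution with the
  \<open>j\<close>-th unit vector on the right; the unit diagonal avoids division. That
  \<open>B\<close> is unitriangular again allows a second application, to \<open>B\<close>.\<close>

lemma unitriangular_right_inverse:
  fixes A :: "'a::ring_1 mat"
  assumes A: "A \<in> carrier_mat m m" and diag: "\<And>i. i < m \<Longrightarrow> A $$ (i, i) = 1"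
    and lower: "\<And>i j. i < m \<Longrightarrow> j < i \<Longrightarrow> A $$ (i, j) = 0"
  shows "\<exists>B \<in> carrier_mat m m. A * B = 1\<^sub>m m \<and> (\<forall>i<m. B $$ (i, i) = 1) \<and>
    (\<forall>i<m. \<forall>j<i. B $$ (i, j) = 0)"
proof -
  define s where "s j = back_subst m (\<lambda>i l. A $$ (i, l)) (\<lambda>i. if i = j then 1 else 0)" for j
  have s: "s j i = (if i = j then 1 else 0) - (\<Sum>l\<in>{i<..<m}. A $$ (i, l) * s j l)" for i j
    unfolding s_def by (rule back_subst.simps)
  have zero: "s j i = 0" if "j < i" for i j
    using that
  proof (induction "m - i" arbitrary: i rule: less_induct)
    case less
    have "(\<Sum>l\<in>{i<..<m}. A $$ (i, l) * s j l) = 0"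
      by (rule sum.neutral) (use less in auto)
    then show ?case using less.prems s[of j i] by simp
  qed
  have one: "s i i = 1" for i
    using s[of i i] zero by simp
  define B where "B = mat m m (\<lambda>(i, j). s j i)"
  have B: "B \<in> carrier_mat m m" by (simp add: B_def)
  have "A * B = 1\<^sub>m m"
  proof (rule eq_matI)
    fix i j assume ij: "i < dim_row (1\<^sub>m m)" "j < dim_col (1\<^sub>m m)"
    then have "(A * B) $$ (i, j) = (\<Sum>l<m. A $$ (i, l) * s j l)"
      using A by (simp add: B_def scalar_prod_def lessThan_atLeast0)
    also have "\<dots> = s j i + (\<Sum>l\<in>{i<..<m}. A $$ (i, l) * s j l)"
      using ij diag lower by (intro sum_unitriangular) auto
    also have "\<dots> = (if i = j then 1 else 0)"
      using s[of j i] by simp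
    finally show "(A * B) $$ (i, j) = 1\<^sub>m m $$ (i, j)" using ij by simp
  qed (use A B in auto)
  then show ?thesis
    by (intro bexI[OF _ B]) (simp add: B_def zero one)
qed

text \<open>The right inverse \<open>B\<close> has itself a right inverse \<open>C\<close>, and
  associativity identifies \<open>C\<close> with \<open>A\<close>, which makes \<open>B\<close>
  two-sided.\<close>

lemma unitriangular_inverse:
  fixes A :: "'a::ring_1 mat"
  assumes A: "A \<in> carrier_mat m m" and "\<And>i. i < m \<Longrightarrow> A $$ (i, i) = 1"
    and "\<And>i j. i < m \<Longrightarrow> j < i \<Longrightarrow> A $$ (i, j) = 0"
  obtains B where "B \<in> carrier_mat m m" "A * B = 1\<^sub>m m" "B * A = 1\<^sub>m m"
proof -
  obtain B where B: "B \<in> carrier_mat m m" "A * B = 1\<^sub>m m"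
    and BB: "\<forall>i<m. B $$ (i, i) = 1" "\<forall>i<m. \<forall>j<i. B $$ (i, j) = 0"
    using unitriangular_right_inverse[OF assms] by blast
  obtain C where C: "C \<in> carrier_mat m m" "B * C = 1\<^sub>m m"
    using unitriangular_right_inverse[OF B(1)] BB by auto
  have "C = (A * B) * C" using B C by simp
  also have "\<dots> = A * (B * C)" using A B(1) C(1) by (rule assoc_mult_mat)
  also have "\<dots> = A" using A C by simp
  finally show ?thesis using that[OF B] C by simp
qed

section \<open>From derivative chains to polynomial systems\<close>

text \<open>The chain becomes the column \<open>A\<^sup>-\<^sup>1 v\<close>: each row of the system
  is the decomposition of \<open>q i\<close> into its constant and the letters times its
  derivatives, the latter expressed by later chain members.\<close>

lemma polynomial_ALS_of_chain:
  fixes p :: "('x::finite, 'k::field) free_algebra"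
  assumes chain: "deriv_chain (p # M)"
  shows "\<exists>u A v. polynomial_ALS (length (p # M)) u A v p"
proof -
  define L where "L = p # M"
  define m where "m = length L"
  define q where "q j = L ! j" for j
  have m: "m > 0" by (simp add: m_def L_def)
  have q0: "q 0 = p" by (simp add: q_def L_def)
  have p: "p \<noteq> 0" using chain free_alg.span_zero[of "set M"] by auto
  have chain_nth: "q i \<notin> free_alg.span (set (drop (Suc i) L)) \<and>
      (\<forall>x. left_deriv x (q i) \<in> free_alg.span (set (drop (Suc i) L)))" if "i < m" for i
    using deriv_chain_drop[of L i] chain that
    by (simp add: L_def[symmetric] m_def q_def Cons_nth_drop_Suc[symmetric])
  have "\<exists>c. left_deriv x (q i) = (\<Sum>j\<in>{Suc i..<m}. scalar (c j) * q j)" if "i < m" for i x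
    using chain_nth[OF that] span_set_drop[of _ "Suc i" L] that by (simp add: m_def q_def)
  then have "\<forall>x i. \<exists>c. i < m \<longrightarrow> left_deriv x (q i) = (\<Sum>j\<in>{i<..<m}. scalar (c j) * q j)"
    by (simp add: atLeastSucLessThan_greaterThanLessThan)
  then obtain \<mu> where "\<forall>x i. i < m \<longrightarrow>
      left_deriv x (q i) = (\<Sum>j\<in>{i<..<m}. scalar (\<mu> x i j) * q j)"
    unfolding choice_iff by blast
  then have \<mu>: "left_deriv x (q i) = (\<Sum>j\<in>{i<..<m}. scalar (\<mu> x i j) * q j)" if "i < m" for i x
    using that by simp
  \<comment> \<open>Nothing follows the last chain element, so its derivatives vanish and it is a
    constant; lying outside the span of the empty set, it is nonzero.\<close>
  define l where "l = const_coeff (q (m - 1))"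
  have "{m - 1<..<m} = {}" by auto
  then have "left_deriv x (q (m - 1)) = 0" for x
    using \<mu>[of "m - 1"] m by simp
  then have last: "q (m - 1) = scalar l"
    using free_algebra_decompose[of "q (m - 1)"] by (simp add: l_def)
  then have l: "l \<noteq> 0"
    using chain_nth[of "m - 1"] m free_alg.span_zero by fastforce
  \<comment> \<open>The constant term of \<open>q i\<close> is written as a multiple of the last
    element \<open>scalar l\<close> and moved to the left-hand side, hence the division and the
    sign.\<close>
  define c where "c i j = (if j = m - 1 then - const_coeff (q i) / l else 0)" for i j
  define a where "a i j = (if j < i then 0 else if i = j then 1 else
      scalar (c i j) + (\<Sum>x\<in>UNIV. scalar (- \<mu> x i j) * letter x))" for i j
  have row: "(\<Sum>j<m. a i j * q j) = scalar (if i = m - 1 then l else 0)" if i: "i < m" for i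
  proof -
    have "(\<Sum>j<m. a i j * q j) = q i + (\<Sum>j\<in>{i<..<m}. a i j * q j)"
      using i by (intro sum_unitriangular) (auto simp: a_def)
    also have "(\<Sum>j\<in>{i<..<m}. a i j * q j) = (\<Sum>j\<in>{i<..<m}. scalar (c i j) * q j) -
        (\<Sum>j\<in>{i<..<m}. \<Sum>x\<in>UNIV. letter x * (scalar (\<mu> x i j) * q j))"
      unfolding sum_subtractf[symmetric]
    proof (rule sum.cong)
      fix j assume j: "j \<in> {i<..<m}"
      \<comment> \<open>Scalars commute with letters, so each coefficient joins \<open>q j\<close>
        to form the derivative.\<close>
      have "scalar (\<mu> x i j) * letter x * q j = letter x * (scalar (\<mu> x i j) * q j)" for x
        by (simp add: scalar_letter_commute mult.assoc)
      then show "a i j * q j = scalar (c i j) * q j - (\<Sum>x\<in>UNIV. letter x * (scalar (\<mu> x i j) * q j))"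
        using j by (simp add: a_def left_diff_distrib sum_distrib_right sum_negf)
    qed simp
    also have "(\<Sum>j\<in>{i<..<m}. \<Sum>x\<in>UNIV. letter x * (scalar (\<mu> x i j) * q j)) =
        (\<Sum>x\<in>UNIV. letter x * left_deriv x (q i))"
      by (subst sum.swap) (simp add: \<mu>[OF i] sum_distrib_left)
    also have "\<dots> = q i - scalar (const_coeff (q i))"
      by (subst (2) free_algebra_decompose) simp
    also have "(\<Sum>j\<in>{i<..<m}. scalar (c i j) * q j) =
        (\<Sum>j\<in>{i<..<m}. if j = m - 1 then scalar (- const_coeff (q i)) else 0)"
      by (rule sum.cong) (auto simp: c_def last[unfolded One_nat_def] l)
    \<comment> \<open>The last index lies in the range exactly when \<open>i\<close> is not itself
      last.\<close>
    also have "\<dots> = (if i = m - 1 then 0 else scalar (- const_coeff (q i)))"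
      using i by (auto simp: sum.delta)
    finally have eq: "(\<Sum>j<m. a i j * q j) = q i +
        ((if i = m - 1 then 0 else scalar (- const_coeff (q i))) - (q i - scalar (const_coeff (q i))))" .
    show ?thesis
    proof (cases "i = m - 1")
      case True
      then show ?thesis unfolding eq l_def by simp
    next
      case False
      then show ?thesis unfolding eq by (simp flip: scalar_simps(3))
    qed
  qed
  define A where "A = mat m m (\<lambda>(i, j). a i j)"
  define Q where "Q = mat m 1 (\<lambda>(i, _). q i)"
  define u :: "'k mat" where "u = mat 1 m (\<lambda>(_, j). if j = 0 then 1 else 0)"
  define v where "v = mat m 1 (\<lambda>(i, _). if i = m - 1 then l else 0)"
  have carrier: "A \<in> carrier_mat m m" "Q \<in> carrier_mat m 1" "u \<in> carrier_mat 1 m" "v \<in> carrier_mat m 1"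
    by (simp_all add: A_def Q_def u_def v_def)
  obtain B where B: "B \<in> carrier_mat m m" "A * B = 1\<^sub>m m" "B * A = 1\<^sub>m m"
    by (rule unitriangular_inverse[OF carrier(1)]) (auto simp: A_def a_def)
  have AQ: "A * Q = map_mat scalar v"
    by (rule eq_matI) (simp_all add: A_def Q_def v_def scalar_prod_def row flip: lessThan_atLeast0)
  \<comment> \<open>As \<open>A * Q\<close> is the right-hand side and \<open>B\<close> inverts
    \<open>A\<close>, the solution is \<open>Q\<close>, of which \<open>u\<close> selects the first
    entry \<open>p\<close>.\<close>
  have "map_mat scalar u * B * map_mat scalar v = map_mat scalar u * (B * (A * Q))"
    unfolding AQ by (rule assoc_mult_mat) (use B carrier in auto)
  also have "B * (A * Q) = (B * A) * Q"
    by (rule assoc_mult_mat[symmetric]) (use B carrier in auto)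
  also have "\<dots> = Q" using B carrier by simp
  also have "map_mat scalar u * Q = mat 1 1 (\<lambda>_. p)"
  proof (rule eq_matI)
    fix i j assume "i < dim_row (mat 1 1 (\<lambda>_. p))" "j < dim_col (mat 1 1 (\<lambda>_. p))"
    moreover have "(\<Sum>k<m. scalar (if k = 0 then 1 else 0) * q k) = q 0"
      using m by (simp add: if_distrib[of scalar] if_distrib[of "\<lambda>y. y * _"] sum.delta cong: if_cong)
    ultimately show "(map_mat scalar u * Q) $$ (i, j) = mat 1 1 (\<lambda>_. p) $$ (i, j)"
      using q0 by (simp add: u_def Q_def scalar_prod_def flip: lessThan_atLeast0)
  qed (simp_all add: u_def Q_def)
  finally have prod: "map_mat scalar u * B * map_mat scalar v = mat 1 1 (\<lambda>_. p)" .
  have affine: "is_affine_linear (a i j)" for i j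
  proof -
    have "\<exists>c. f = scalar c \<Longrightarrow> is_affine_linear f" for f :: "('x, 'k) free_algebra"
      unfolding is_affine_linear_def by (force intro: exI[of _ "\<lambda>_. 0"])
    then have "is_affine_linear (0 :: ('x, 'k) free_algebra)"
      "is_affine_linear (1 :: ('x, 'k) free_algebra)"
      by (metis scalar_simps)+
    moreover have "is_affine_linear (scalar (c i j) + (\<Sum>x\<in>UNIV. scalar (- \<mu> x i j) * letter x))"
      unfolding is_affine_linear_def
      by (rule exI[of _ "c i j"], rule exI[of _ "\<lambda>x. - \<mu> x i j"], rule refl)
    ultimately show ?thesis by (simp add: a_def)
  qed
  have "linear_representation m u A v p"
    unfolding linear_representation_def inverts_mat_def
    using carrier B prod affine by (auto simp: A_def)
  then have "polynomial_ALS m u A v p"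
    unfolding polynomial_ALS_def using p by (auto simp: u_def v_def A_def a_def)
  then show ?thesis unfolding m_def L_def by blast
qed

text \<open>A spanning chain is taken and \<open>p\<close> is moved to its front. In the theorem
  this yields some system, then one of dimension at most the rank, and finally a competitor for the
  rank in the lower bound.\<close>

lemma polynomial_ALS_exists:
  fixes p :: "('x::finite, 'k::field) free_algebra"
  assumes "finite T" "deriv_closed T"
    and "p \<in> free_alg.span T" "p \<noteq> 0"
  shows "\<exists>m u A v. m \<le> card T \<and> polynomial_ALS m u A v p"
proof -
  obtain L where L: "deriv_chain L" "length L \<le> card T" "free_alg.span T \<subseteq> free_alg.span (set L)"
    using deriv_chain_spanning[OF assms(1,2)] by blast
  then obtain M where "deriv_chain (p # M)" "length (p # M) \<le> length L"
    using deriv_chain_exchange assms(3,4) by blast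
  then show ?thesis
    using polynomial_ALS_of_chain[of p M] L(2) by (intro exI[of _ "length (p # M)"]) simp
qed

section \<open>From linear representations to derivative-closed sets\<close>

text \<open>The \<open>s j\<close> are the entries of \<open>A\<^sup>-\<^sup>1 v\<close>; the
  inverse gives way to equations that can be differentiated.\<close>

lemma linear_representation_solution:
  assumes "linear_representation n u A v p"
  obtains s where "\<And>i. i < n \<Longrightarrow> (\<Sum>j<n. A $$ (i, j) * s j) = scalar (v $$ (i, 0))"
    "p = (\<Sum>j<n. scalar (u $$ (0, j)) * s j)"
proof -
  obtain B where car: "u \<in> carrier_mat 1 n" "A \<in> carrier_mat n n" "v \<in> carrier_mat n 1"
      "B \<in> carrier_mat n n"
    and AB: "A * B = 1\<^sub>m n"
    and prod: "map_mat scalar u * B * map_mat scalar v = mat 1 1 (\<lambda>_. p)"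
    using assms unfolding linear_representation_def inverts_mat_def by auto
  define S where "S = B * map_mat scalar v"
  have S: "S \<in> carrier_mat n 1" using car by (simp add: S_def)
  have "A * S = (A * B) * map_mat scalar v"
    unfolding S_def by (rule assoc_mult_mat[symmetric]) (use car in auto)
  also have "\<dots> = map_mat scalar v" using car AB by simp
  finally have AS: "A * S = map_mat scalar v" .
  have uS: "map_mat scalar u * S = mat 1 1 (\<lambda>_. p)"
    unfolding S_def prod[symmetric] by (rule assoc_mult_mat[symmetric]) (use car in auto)
  show ?thesis
  proof (rule that[of "\<lambda>j. S $$ (j, 0)"])
    show "(\<Sum>j<n. A $$ (i, j) * S $$ (j, 0)) = scalar (v $$ (i, 0))" if "i < n" for i
      using arg_cong[OF AS, of "\<lambda>X. X $$ (i, 0)"] car S that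
      by (simp add: scalar_prod_def lessThan_atLeast0)
    show "p = (\<Sum>j<n. scalar (u $$ (0, j)) * S $$ (j, 0))"
      using arg_cong[OF uS, of "\<lambda>X. X $$ (0, 0)"] car S
      by (simp add: scalar_prod_def lessThan_atLeast0)
  qed
qed

text \<open>The product rule applied to one row, whose constant right-hand side has derivative
  zero.\<close>

lemma deriv_solution:
  assumes "(\<Sum>j<n. a j * s j) = scalar c"
  shows "(\<Sum>j<n. scalar (const_coeff (a j)) * left_deriv x (s j)) = - (\<Sum>j<n. left_deriv x (a j) * s j)"
  using arg_cong[OF assms, of "left_deriv x"]
  by (simp add: left_deriv_mult sum.distrib eq_neg_iff_add_eq_0)

lemma span_is_scalar_mult:
  "is_scalar f \<Longrightarrow> g \<in> free_alg.span T \<Longrightarrow> f * g \<in> free_alg.span T"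
  by (auto simp: is_scalar_def intro: free_alg.span_scale)

text \<open>The constant part of \<open>A\<close> is invertible over the ground field, which expresses the
  derivatives of \<open>A\<^sup>-\<^sup>1 v\<close> through its entries.\<close>

lemma linear_representation_closed_set:
  fixes p :: "('x::finite, 'k::field) free_algebra"
  assumes rep: "linear_representation n u A v p"
  obtains T where "finite T" "deriv_closed T" "card T \<le> n" "p \<in> free_alg.span T"
proof -
  obtain B where car: "A \<in> carrier_mat n n" "B \<in> carrier_mat n n" and BA: "B * A = 1\<^sub>m n"
    and affine: "\<And>i j. i < n \<Longrightarrow> j < n \<Longrightarrow> is_affine_linear (A $$ (i, j))"
    using rep unfolding linear_representation_def inverts_mat_def by auto
  obtain s where s: "\<And>i. i < n \<Longrightarrow> (\<Sum>j<n. A $$ (i, j) * s j) = scalar (v $$ (i, 0))"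
    and p: "p = (\<Sum>j<n. scalar (u $$ (0, j)) * s j)"
    using linear_representation_solution[OF rep] by blast
  define T where "T = s ` {..<n}"
  have sT: "s j \<in> free_alg.span T" if "j < n" for j
    using that by (auto simp: T_def intro: free_alg.span_base)
  \<comment> \<open>\<open>const_coeff\<close> is a ring homomorphism, so \<open>b\<close> is a left
    inverse of the constant part of \<open>A\<close>.\<close>
  define b where "b k i = const_coeff (B $$ (k, i))" for k i
  have inv: "(\<Sum>i<n. b k i * const_coeff (A $$ (i, j))) = (if k = j then 1 else 0)"
    if "k < n" "j < n" for k j
    using arg_cong[OF BA, of "\<lambda>X. const_coeff (X $$ (k, j))"] car that
    by (simp add: b_def scalar_prod_def lessThan_atLeast0)
  have "left_deriv x (s k) \<in> free_alg.span T" if k: "k < n" for k x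
  proof -
    \<comment> \<open>Combining the differentiated rows with row \<open>k\<close> of
      \<open>b\<close> isolates the derivative of \<open>s k\<close>.\<close>
    have "(\<Sum>i<n. scalar (b k i) * (\<Sum>j<n. scalar (const_coeff (A $$ (i, j))) * left_deriv x (s j))) =
        (\<Sum>i<n. \<Sum>j<n. scalar (b k i * const_coeff (A $$ (i, j))) * left_deriv x (s j))"
      by (simp add: sum_distrib_left flip: mult.assoc)
    also have "\<dots> = (\<Sum>j<n. \<Sum>i<n. scalar (b k i * const_coeff (A $$ (i, j))) * left_deriv x (s j))"
      by (rule sum.swap)
    also have "\<dots> = (\<Sum>j<n. scalar (\<Sum>i<n. b k i * const_coeff (A $$ (i, j))) * left_deriv x (s j))"
      by (simp add: free_alg.scale_sum_left)
    also have "\<dots> = (\<Sum>j<n. if k = j then left_deriv x (s j) else 0)"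
      by (rule sum.cong) (simp_all add: inv k)
    also have "\<dots> = left_deriv x (s k)" using k by simp
    finally have "left_deriv x (s k) =
        (\<Sum>i<n. scalar (b k i) * - (\<Sum>j<n. left_deriv x (A $$ (i, j)) * s j))"
      using deriv_solution[OF s, of _ x] by simp
    also have "\<dots> \<in> free_alg.span T"
      by (intro free_alg.span_sum free_alg.span_scale free_alg.span_neg span_is_scalar_mult
          left_deriv_affine_linear affine sT) auto
    finally show ?thesis .
  qed
  then have "deriv_closed T"
    unfolding deriv_closed_def by (auto simp: T_def)
  moreover have "p \<in> free_alg.span T"
    unfolding p by (intro free_alg.span_sum free_alg.span_scale sT) simp
  moreover have "finite T" "card T \<le> n"
    using card_image_le[of "{..<n}" s] by (simp_all add: T_def)
  ultimately show ?thesis using that by blast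
qed

text \<open>With \<open>s = A\<^sup>-\<^sup>1 v\<close>, the witness consists of \<open>p = s\<^sub>0\<close>, \<open>1\<close> and the \<open>s\<^sub>j\<close> for the columns (rows)
  \<open>j\<close> with a non-scalar entry in the upper left (lower right) block, whichever block has fewer
  non-scalar entries.\<close>

lemma polynomial_ALS_closed_set:
  fixes p :: "('x::finite, 'k::field) free_algebra"
  assumes ALS: "polynomial_ALS m u A v p"
  obtains T where "finite T" "deriv_closed T" "card T \<le> ALS_mults m A + 2" "p \<in> free_alg.span T"
proof -
  define J where "J = {(i, j). i < m - 1 \<and> j < m - 1 \<and> \<not> is_scalar (A $$ (i, j))}"
  define I where "I = {(i, j). 1 \<le> i \<and> i < m \<and> 1 \<le> j \<and> j < m \<and> \<not> is_scalar (A $$ (i, j))}"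
  have mults: "ALS_mults m A = min (card J) (card I)"
    by (simp only: ALS_mults_def left_mults_def right_mults_def I_def J_def)
  have "finite J"
    by (rule finite_subset[of _ "{..<m} \<times> {..<m}"]) (auto simp: J_def)
  have "finite I"
    by (rule finite_subset[of _ "{..<m} \<times> {..<m}"]) (auto simp: I_def)
  have rep: "linear_representation m u A v p" and p: "p \<noteq> 0"
    and u: "\<And>j. j < m \<Longrightarrow> u $$ (0, j) = (if j = 0 then 1 else 0)"
    and diag: "\<And>i. i < m \<Longrightarrow> A $$ (i, i) = 1"
    and lower: "\<And>i j. i < m \<Longrightarrow> j < i \<Longrightarrow> A $$ (i, j) = 0"
    using ALS unfolding polynomial_ALS_def by auto
  obtain l where v: "\<And>i. i < m \<Longrightarrow> v $$ (i, 0) = (if i = m - 1 then l else 0)"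
    using ALS unfolding polynomial_ALS_def by auto
  obtain s where s: "\<And>i. i < m \<Longrightarrow> (\<Sum>j<m. A $$ (i, j) * s j) = scalar (v $$ (i, 0))"
    and ps: "p = (\<Sum>j<m. scalar (u $$ (0, j)) * s j)"
    using linear_representation_solution[OF rep] by blast
  have m: "m > 0"
    using ps p by (cases m) auto
  have "p = (\<Sum>j<m. if j = 0 then s j else 0)"
    unfolding ps by (rule sum.cong) (simp_all add: u)
  then have p0: "p = s 0" using m by simp
  have row: "s i = scalar (v $$ (i, 0)) - (\<Sum>j\<in>{i<..<m}. A $$ (i, j) * s j)" if "i < m" for i
    using s[OF that] sum_unitriangular[of i m "\<lambda>j. A $$ (i, j)" s] diag lower that
    by (simp add: eq_diff_eq)
  have "{m - 1<..<m} = {}" by auto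
  then have last: "s (m - 1) = scalar l"
    using row[of "m - 1"] m by (simp add: v)
  have one: "scalar c \<in> free_alg.span (insert 1 W)" for c and W :: "('x, 'k) free_algebra set"
    using free_alg.span_scale[of 1 "insert 1 W" c] by (simp add: free_alg.span_base)
  \<comment> \<open>Induction from the last row upwards. In the derivative of
    \<open>A $$ (i, j) * s j\<close>, the term with the derivative of \<open>s j\<close> is covered
    by induction; the other vanishes for a scalar entry and is otherwise a scalar multiple of
    \<open>s j\<close>.\<close>
  have deriv: "left_deriv x (s i) \<in> free_alg.span W"
    if W: "\<And>i j. i < j \<Longrightarrow> j < m \<Longrightarrow> is_scalar (A $$ (i, j)) \<or> s j \<in> free_alg.span W" and "i < m"
    for W i x
    using that(2)
  proof (induction "m - i" arbitrary: i rule: less_induct)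
    case less
    have "A $$ (i, j) * s j \<in> {f. left_deriv x f \<in> free_alg.span W}" if "j \<in> {i<..<m}" for j
    proof -
      have "left_deriv x (s j) \<in> free_alg.span W"
        using that less by auto
      moreover have "left_deriv x (A $$ (i, j)) * s j \<in> free_alg.span W"
      proof -
        have "is_affine_linear (A $$ (i, j))"
          using rep that less.prems by (auto simp: linear_representation_def)
        then have "is_scalar (left_deriv x (A $$ (i, j)))"
          by (rule left_deriv_affine_linear)
        then show ?thesis
          using W[of i j] that span_is_scalar_mult
          by (auto simp: left_deriv_is_scalar free_alg.span_zero)
      qed
      ultimately show ?thesis
        by (simp add: left_deriv_mult free_alg.span_add free_alg.span_scale)
    qed
    then have "- (\<Sum>j\<in>{i<..<m}. left_deriv x (A $$ (i, j) * s j)) \<in> free_alg.span W"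
      by (intro free_alg.span_neg free_alg.span_sum) simp
    then show ?case
      by (subst row[OF less.prems]) (simp add: diff_conv_add_uminus del: add_uminus_conv_diff)
  qed
  \<comment> \<open>As \<open>p = s 0\<close>, every generator other than \<open>1\<close> is some
    \<open>s i\<close> and falls under \<open>deriv\<close>.\<close>
  have closed: "deriv_closed (insert p (insert 1 (s ` K)))" if "K \<subseteq> {..<m}"
    and scalar_or_span: "\<And>i j. i < j \<Longrightarrow> j < m \<Longrightarrow>
      is_scalar (A $$ (i, j)) \<or> s j \<in> free_alg.span (insert 1 (s ` K))" for K
    unfolding deriv_closed_def
  proof (intro ballI allI)
    fix t x assume t: "t \<in> insert p (insert 1 (s ` K))"
    show "left_deriv x t \<in> free_alg.span (insert p (insert 1 (s ` K)))"
    proof (cases "t = 1")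
      case True
      then show ?thesis
        using left_deriv_is_scalar[of t x] by (simp add: free_alg.span_zero)
    next
      case False
      then obtain i where "i < m" "t = s i" using t \<open>K \<subseteq> {..<m}\<close> p0 m by auto
      then have "left_deriv x t \<in> free_alg.span (insert 1 (s ` K))"
        using deriv[OF scalar_or_span] by simp
      then show ?thesis by (rule subsetD[OF free_alg.span_mono, rotated]) auto
    qed
  qed
  \<comment> \<open>\<open>f\<close> will be \<open>snd\<close> for columns and \<open>fst\<close>
    for rows; entries sharing a column or row only lower the cardinality.\<close>
  have card: "card (insert p (insert 1 (s ` f ` S))) \<le> card S + 2" if "finite S"
    for f and S :: "(nat \<times> nat) set"
  proof -
    have "card (insert p (insert 1 (s ` f ` S))) \<le> Suc (Suc (card (s ` f ` S)))"
      using that by (simp add: card_insert_if)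
    also have "\<dots> \<le> card S + 2"
      using card_image_le[OF that, of "s \<circ> f"] by (simp add: image_comp)
    finally show ?thesis .
  qed
  show ?thesis
  proof (cases "card J \<le> card I")
    case True
    have sub: "snd ` J \<subseteq> {..<m}" by (auto simp: J_def)
    \<comment> \<open>The last column lies outside the block, but \<open>s (m - 1)\<close> is a
      constant.\<close>
    have "is_scalar (A $$ (i, j)) \<or> s j \<in> free_alg.span (insert 1 (s ` snd ` J))"
      if "i < j" "j < m" for i j
    proof (cases "j = m - 1")
      case False
      then have "(i, j) \<in> J" if "\<not> is_scalar (A $$ (i, j))"
        using that \<open>i < j\<close> \<open>j < m\<close> by (auto simp: J_def)
      then show ?thesis by (force intro: free_alg.span_base)
    qed (simp add: last[unfolded One_nat_def] one)
    note closed[OF sub this]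
    moreover have "card (insert p (insert 1 (s ` snd ` J))) \<le> ALS_mults m A + 2"
      using card[OF \<open>finite J\<close>, of snd] True
      by (simp add: mults)
    ultimately show ?thesis
      using \<open>finite J\<close> by (intro that) (auto intro: free_alg.span_base)
  next
    case False
    have sub: "fst ` I \<subseteq> {..<m}" by (auto simp: I_def)
    \<comment> \<open>Again from the last row upwards: a row with only scalar entries in the block
      expresses \<open>s j\<close> by a constant and scalar multiples of later entries.\<close>
    have "s j \<in> free_alg.span (insert 1 (s ` fst ` I))" if "1 \<le> j" "j < m" for j
      using that
    proof (induction "m - j" arbitrary: j rule: less_induct)
      case less
      show ?case
      proof (cases "j \<in> fst ` I")
        case True
        then show ?thesis by (auto intro: free_alg.span_base)
      next
        case False
        then have "(j, k) \<notin> I" for k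
          by (metis fst_conv image_eqI)
        then have "is_scalar (A $$ (j, k))" if "k \<in> {j<..<m}" for k
          using that less.prems by (auto simp: I_def)
        then have "(\<Sum>k\<in>{j<..<m}. A $$ (j, k) * s k) \<in> free_alg.span (insert 1 (s ` fst ` I))"
          using less by (intro free_alg.span_sum span_is_scalar_mult) auto
        then have "scalar (v $$ (j, 0)) - (\<Sum>k\<in>{j<..<m}. A $$ (j, k) * s k)
            \<in> free_alg.span (insert 1 (s ` fst ` I))"
          by (rule free_alg.span_diff[OF one])
        then show ?thesis
          unfolding row[OF less.prems(2), symmetric] .
      qed
    qed
    \<comment> \<open>Row \<open>0\<close> lies outside the block, but \<open>i < j\<close> forces
      \<open>j\<close> to be positive.\<close>
    then have "is_scalar (A $$ (i, j)) \<or> s j \<in> free_alg.span (insert 1 (s ` fst ` I))"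
      if "i < j" "j < m" for i j
      using that by auto
    note closed[OF sub this]
    moreover have "card (insert p (insert 1 (s ` fst ` I))) \<le> ALS_mults m A + 2"
      using card[OF \<open>finite I\<close>, of fst] False
      by (simp add: mults)
    ultimately show ?thesis
      using \<open>finite I\<close> by (intro that) (auto intro: free_alg.span_base)
  qed
qed

text \<open>All words up to the degree of \<open>p\<close> serve: a finite alphabet gives finitely
  many, and a derivative deletes a letter or gives zero.\<close>

lemma deriv_closed_set_exists:
  fixes p :: "('x::finite, 'k::field) free_algebra"
  obtains T where "finite T" "deriv_closed T" "p \<in> free_alg.span T"
proof -
  obtain N where N: "\<And>w. w \<in> Poly_Mapping.keys p \<Longrightarrow> length (letters w) \<le> N"
    using length_letters_bounded[of p] less_imp_le by metis
  define T :: "('x, 'k) free_algebra set"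
    where "T = (\<lambda>w. Poly_Mapping.single (Letters w) 1) ` {w. length w \<le> N}"
  have T: "Poly_Mapping.single w 1 \<in> free_alg.span T" if "length (letters w) \<le> N" for w
    using that by (cases w) (auto simp: T_def intro: free_alg.span_base)
  have "finite T"
    using finite_lists_length_le[of "UNIV :: 'x set" N] by (simp add: T_def)
  moreover have "p \<in> free_alg.span T"
  proof -
    have "Poly_Mapping.single w c \<in> free_alg.span T" if "w \<in> Poly_Mapping.keys p" for w c
      using free_alg.span_scale[OF T[OF N[OF that]], of c] by (simp add: scalar_def mult_single)
    then show ?thesis
      by (subst sum_single_lookup[of p, symmetric]) (auto intro: free_alg.span_sum)
  qed
  moreover have "deriv_closed T"
    unfolding deriv_closed_def
  proof (intro ballI allI)
    fix t x assume "t \<in> T"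
    then obtain w where w: "length w \<le> N" "t = Poly_Mapping.single (Letters w) 1"
      by (auto simp: T_def)
    then show "left_deriv x t \<in> free_alg.span T"
      by (cases w) (auto simp: left_deriv_single free_alg.span_zero intro: T)
  qed
  ultimately show ?thesis using that by blast
qed

section \<open>Counting multiplications\<close>

lemma card_pairs_less: "2 * card {(i, j). i < j \<and> j < (n::nat)} = n * (n - 1)"
proof -
  have "{(i, j). i < j \<and> j < n} = (\<lambda>(j, i). (i, j)) ` (SIGMA j:{..<n}. {..<j})"
    by auto
  then have "card {(i, j). i < j \<and> j < n} = card (SIGMA j:{..<n}. {..<j})"
    by (simp add: card_image inj_on_def)
  also have "\<dots> = (\<Sum>j<n. j)"
    by simp
  finally have "card {(i, j). i < j \<and> j < n} = (\<Sum>j<n. j)" .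
  moreover have "2 * (\<Sum>j<n. j) = n * (n - 1)"
  proof (induction n)
    case (Suc n)
    then show ?case by (cases n) (simp_all add: algebra_simps)
  qed simp
  ultimately show ?thesis by simp
qed

text \<open>Non-scalar entries lie strictly above the diagonal. Since a minimum is taken, counting
  such positions in the upper left block suffices.\<close>

lemma ALS_mults_le:
  assumes "polynomial_ALS m u A v p"
  shows "2 * ALS_mults m A \<le> (m - 1) * (m - 2)"
proof -
  have "i < j" if "i < m" "j < m" "\<not> is_scalar (A $$ (i, j))" for i j
  proof (rule ccontr)
    assume "\<not> i < j"
    then consider "i = j" | "j < i" by linarith
    then have "A $$ (i, j) = 1 \<or> A $$ (i, j) = 0"
      using assms that(1) unfolding polynomial_ALS_def by cases auto
    then show False using that(3) by auto
  qed
  then have "{(i, j). i < m - 1 \<and> j < m - 1 \<and> \<not> is_scalar (A $$ (i, j))} \<subseteq>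
      {(i, j). i < j \<and> j < m - 1}" by auto
  moreover have "finite {(i, j). i < j \<and> j < m - 1}"
    by (rule finite_subset[of _ "{..<m} \<times> {..<m}"]) auto
  ultimately have "left_mults m A \<le> card {(i, j). i < j \<and> j < m - 1}"
    unfolding left_mults_def by (rule card_mono[rotated])
  then show ?thesis
    using card_pairs_less[of "m - 1"] by (simp add: ALS_mults_def numeral_2_eq_2)
qed

theorem proposition2p10:
  fixes p :: "('x::finite, 'k::field) free_algebra" and n :: nat
  assumes "nc_rank p = n" and "n \<ge> 2"
  shows "real n - 2 \<le> real (num_mults p) \<and>
         real (num_mults p) \<le> 1 / 2 * (real n - 1) * (real n - 2)"
proof -
  have minimal: "n \<le> m" if "linear_representation m u A v p" for m u A v
    using that assms(1) unfolding nc_rank_def by (auto intro: Least_le)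
  \<comment> \<open>The empty representation has dimension \<open>0\<close> and represents
    \<open>0\<close>, so rank at least 2 excludes \<open>p = 0\<close>.\<close>
  have "linear_representation 0 (0\<^sub>m 1 0) (0\<^sub>m 0 0) (0\<^sub>m 0 1) (0 :: ('x, 'k) free_algebra)"
    unfolding linear_representation_def inverts_mat_def
    by (auto intro!: bexI[of _ "0\<^sub>m 0 0"] eq_matI simp: scalar_prod_def)
  then have p: "p \<noteq> 0"
    using minimal assms(2) by fastforce
  obtain m u A v where ALS: "polynomial_ALS m u A v p" and N: "num_mults p = ALS_mults m A"
    and upper: "2 * num_mults p \<le> (n - 1) * (n - 2)"
  proof -
    obtain S where "finite S" "deriv_closed S" "p \<in> free_alg.span S"
      using deriv_closed_set_exists by blast
    then obtain m u A v where "polynomial_ALS m u A v p"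
      using polynomial_ALS_exists[OF _ _ _ p] by blast
    then have "linear_representation m u A v p"
      by (simp add: polynomial_ALS_def)
    \<comment> \<open>Once some representation exists, the least dimension \<open>n\<close> is
      attained.\<close>
    then have "\<exists>m u A v. linear_representation m u A v p"
      by blast
    then have "\<exists>u A v. linear_representation n u A v p"
      unfolding assms(1)[symmetric] nc_rank_def by (rule LeastI_ex)
    then obtain u A v where "linear_representation n u A v p"
      by blast
    then obtain T where T: "finite T" "deriv_closed T" "card T \<le> n" "p \<in> free_alg.span T"
      using linear_representation_closed_set by blast
    \<comment> \<open>The bound on the count is monotone in the dimension, so
      \<open>k \<le> n\<close> is enough.\<close>
    obtain k u A v where k: "k \<le> n" "polynomial_ALS k u A v p"
      using polynomial_ALS_exists[OF T(1,2,4) p] T(3) by (metis order_trans)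
    define Q where "Q N \<longleftrightarrow> (\<exists>m u A v. polynomial_ALS m u A v p \<and> N = ALS_mults m A)" for N
    have N: "num_mults p = (LEAST N. Q N)"
      by (simp add: num_mults_def Q_def)
    have Q: "Q (ALS_mults k A)"
      using k unfolding Q_def by blast
    have "2 * num_mults p \<le> 2 * ALS_mults k A"
      unfolding N using Least_le[of Q, OF Q] by simp
    also have "\<dots> \<le> (k - 1) * (k - 2)"
      using k(2) by (rule ALS_mults_le)
    also have "\<dots> \<le> (n - 1) * (n - 2)"
      using k(1) by (intro mult_le_mono) auto
    \<comment> \<open>\<open>LeastI\<close> supplies a system attaining the minimum, from which the
      lower bound starts.\<close>
    finally show ?thesis
      using that LeastI[of Q, OF Q] unfolding N[symmetric] unfolding Q_def by blast
  qed
  obtain T where T: "finite T" "deriv_closed T" "card T \<le> num_mults p + 2" "p \<in> free_alg.span T"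
    using polynomial_ALS_closed_set[OF ALS] unfolding N by blast
  \<comment> \<open>Turning the closed set back into a representation brings in the minimality of
    \<open>n\<close>.\<close>
  then obtain m' u' A' v' where "m' \<le> card T" "polynomial_ALS m' u' A' v' p"
    using polynomial_ALS_exists[OF T(1,2,4) p] by blast
  then have "n \<le> num_mults p + 2"
    using minimal[of m' u' A' v'] T(3) unfolding polynomial_ALS_def by simp
  \<comment> \<open>With \<open>n \<ge> 2\<close> the truncated subtractions agree with the real
    ones.\<close>
  moreover have "2 * real (num_mults p) \<le> (real n - 1) * (real n - 2)"
    using of_nat_mono[OF upper, where 'a = real] assms(2) by (simp add: of_nat_diff)
  ultimately show ?thesis by simp
qed

end
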